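(* Let $\gamma$ be a synchronous intersection context and let $\sigma$ be an intersection policy for $\gamma$. Then there exists a behaviorally unique action protocol $P$ implementing the knowledge-based program $\mathbf P^\sigma$ with respect to $\gamma$. Moreover, if $\sigma$ is a correct intersection policy with respect to $\gamma$, then every implementation $P$ of $\mathbf P^\sigma$ with respect to $\gamma$ satisfies Safety and Validity.
   Context: **Setting.** $\mathrm{Ag}\subseteq\mathbb N$ is a (possibly infinite) set of agents. Lanes $\mathcal L=\{0,\dots,\ell-1\}$ are partitioned into incoming lanes $\mathcal L_{in}=\{0,\dots,k-1\}$ ($1<k<\ell$) and outgoing lanes $\mathcal L_{out}$. A move is an element of $\mathcal L_{in}\times\mathcal L_{out}$. A symmetric relation $\mathcal O\subseteq(\mathcal L_{in}\times\mathcal L_{out})^2$ is fixed; two moves are compatible if the pair is in $\mathcal O$. **Adversaries.** A transmission environment is $T\subseteq(\mathcal L_{in}\times\mathbb N)^2$ with $((l,0),(l',0))\in T$ for all $l,l'\in\mathcal L_{in}$. An adversary is $\alpha=(\tau,T,F_t,F_r)$ with $\tau:\mathrm{Ag}\to\mathbb N\times\mathcal L_{in}\times\mathcal L_{out}$ (arrival time, arrival lane, intended departure lane), where distinct agents with the same arrival time have different arrival lanes; $T$ a transmission environment; $F_t,F_r:\mathbb N\times\mathrm{Ag}\to\{0,1\}$ (value $0$ at $(m,i)$: $i$'s transmitter, resp. receiver, fails in round $m+1$, i.e. between times $m$ and $m+1$). An adversary model $\mathcal F$ is a set of adversaries. **Intersection contexts.** An environment state is $s_e=(\alpha,t,(q_l)_{l\in\mathcal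 L_{in}},\mathit{done})$: an adversary $\alpha\in\mathcal F$, a time $t\in\mathbb N$, a queue $q_l$ of agents per incoming lane, and a set $\mathit{done}\subseteq\mathrm{Ag}$. $\mathit{pos}_i=p$ if $i$ is in position $p$ of some queue (front is position $0$), $\top$ if $i\in\mathit{done}$, $\bot$ otherwise. Agent $i$'s sensor reading $\mathscr S_i(s_e)\in\Sigma_i$ contains $\mathit{front}_i$ ($=1$ iff $\mathit{pos}_i=0$), $\mathit{lane}_i$ ($=l$ if $i$ is in $q_l$, $\top$ if $i\in\mathit{done}$, $\bot$ otherwise) and $\mathit{intent}_i$ (the departure lane in $\tau(i)$), and possibly further components that are functions of $s_e$ (such as the time). An information-exchange protocol $\mathcal E$ gives for each agent $i$: a set $\mathit{Mem}_i$ of memory states with a subset of initial ones, local states $L_i=\mathit{Mem}_i\times\Sigma_i$, actions $A_i=\{\mathtt{go},\mathtt{noop}\}$, messages $M_i$, $\mu_i:L_i\times A_i\times\Sigma_i\to M_i\cup\{\bot\}$ ($\bot$: no message) and $\delta_i:L_i\times A_i\times\mathcal P(\bigcup_jM_j)\to\mathit{Mem}_i$. An intersection context is $\gamma=(\mathcal E,\mathcal F,\pi)$, where $\pi$ interprets atomic propositions about $\mathit{front}_i,\mathit{lane}_i,\mathit{intent}_i,\mathit{pos}_i$ according to the global state. An action protocol $P$ for $\gamma$ consists of maps $P_i:L_i\to A_i$; $\mathtt{go}$ can be performed only by an agent at the front of its queue ($P_i(s)=\mathtt{go}$ only if $\mathit{front}_i=1$ in $s$). **Runs.** Global states are $(s_e,(s_i)_{i\in\mathrm{Ag}})$.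 Initially $t=0$, all queues and $\mathit{done}$ are empty, and $s_i=(u_i,\mathscr S_i(s_e))$ with $u_i$ an initial memory state. In round $m+1$: each $i$ performs $P_i(s_i)$; each agent at the front of a queue performing $\mathtt{go}$ is dequeued and added to $\mathit{done}$; then each agent $i$ with $\tau(i)=(m+1,l,l')$ is appended to $q_l$; time becomes $m+1$ and $\alpha$ is unchanged, giving $s_e'$. Each $i$ broadcasts $m_i=\mu_i(s_i,P_i(s_i),\mathscr S_i(s_e'))$. $B_i=\emptyset$ if $i$ is in no queue in $s'_e$ or $F_r(m,i)=0$; otherwise $B_i$ is the set of (non-$\bot$) $m_j$ for agents $j$ in some queue with ((lane, position) of $j$, (lane, position) of $i$)$\,\in T$ (in $s'_e$) and $F_t(m,j)=1$. The new local state is $s_i'=(\delta_i(s_i,P_i(s_i),B_i),\mathscr S_i(s'_e))$. $\mathcal I_{\gamma,P}$ is the interpreted system of all such runs $r:\mathbb N\to$ global states; $r_i(m)$ is $i$'s local state at point $(r,m)$. $K_i\phi$ holds at $(r,m)$ iff $\phi$ holds at all points $(r',m')$ with $r'_i(m')=r_i(m)$; $\bigcirc\phi$ holds at $(r,m)$ iff $\phi$ holds at $(r,m+1)$. A formula is valid if it holds at all points. $\gamma$ is synchronous if agents always know the time from their local state: for every protocol $P$, points $(r,m),(r',m')$ of $\mathcal I_{\gamma,P}$ and agent $i$, $r_i(m)=r'_i(m')$ implies $m=m'$. **Safety, Validity.** $\mathit{going}_i:=\mathit{front}_i\wedge\bigcirc\neg\mathit{front}_i$. Validity: $\mathit{going}_i\Rightarrow\mathit{front}_i$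 is valid in $\mathcal I_{\gamma,P}$ for all $i$. Safety: $(\mathit{going}_i\wedge\mathit{going}_j)\Rightarrow((\mathit{lane}_i,\mathit{intent}_i),(\mathit{lane}_j,\mathit{intent}_j))\in\mathcal O$ is valid in $\mathcal I_{\gamma,P}$ for all $i\neq j$. **Policies.** For an adversary $\alpha=(\tau,T,F_t,F_r)$ and $m\in\mathbb N$, $\alpha_m=(\tau^m,T,F_r^m,F_t^m)$ with $\tau^m=\{(i,l,l'):\tau(i)=(m+1,l,l')\}$ and $F_a^m(i)=F_a(m,i)$ for $a\in\{r,t\}$. $H(\alpha,m)=\langle\alpha_0,\dots,\alpha_{m-1}\rangle$; $H(r,m)=H(\alpha,m)$ if $r$ has adversary $\alpha$. $\mathcal H_\gamma$ is the set of all $H(\alpha,m)$ with $\alpha\in\mathcal F$, $m\ge0$. An intersection policy for $\gamma$ is a map $\sigma:\mathcal H_\gamma\to\mathcal P(\mathcal L_{in}\times\mathcal L_{out})$. It is conflict-free if for every $h\in\mathcal H_\gamma$ any two distinct moves in $\sigma(h)$ are compatible. It is fair if for every $\alpha\in\mathcal F$, every move $(l,l')$ and every $m\ge0$ there is $m'\ge m$ with $(l,l')\in\sigma(H(\alpha,m'))$. It is correct if it is conflict-free and fair. **Knowledge-based program.** $\mathbf P^\sigma$: agent $i$ does "if $K_i(\mathit{front}_i\wedge(\mathit{lane}_i,\mathit{intent}_i)\in\sigma)$ then $\mathtt{go}$ else $\mathtt{noop}$", where $(\mathit{lane}_i,\mathit{intent}_i)\in\sigma$ holds at $(r,m)$ iff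 the values of $(\mathit{lane}_i,\mathit{intent}_i)$ at $(r,m)$ belong to $\sigma(H(r,m))$. An action protocol $P$ implements a program "if $K_i\phi_i$ then $\mathtt{go}$ else $\mathtt{noop}$" w.r.t. $\gamma$ if for all points $(r,m)$ of $\mathcal I_{\gamma,P}$ and all $i$: $P_i(r_i(m))=\mathtt{go}$ iff $K_i\phi_i$ holds at $(r,m)$ in $\mathcal I_{\gamma,P}$. Behaviorally unique: any two implementations take the same actions at all reachable local states (they can differ only on unreachable states). *)

theory Defs
  imports Main "HOL-Library.FuncSet"
begin

type_synonym agent = nat
type_synonym lane = nat
type_synonym move = "lane \<times> lane"

record setting =
  agents :: "agent set"
  num_lanes :: nat
  num_in :: nat
  compat :: "(move \<times> move) set"

definition in_lanes :: "'z setting_scheme \<Rightarrow> lane set" where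
  "in_lanes S = {0..<num_in S}"

definition out_lanes :: "'z setting_scheme \<Rightarrow> lane set" where
  "out_lanes S = {num_in S..<num_lanes S}"

definition moves :: "'z setting_scheme \<Rightarrow> move set" where
  "moves S = in_lanes S \<times> out_lanes S"

definition setting_wf :: "'z setting_scheme \<Rightarrow> bool" where
  "setting_wf S \<longleftrightarrow> 1 < num_in S \<and> num_in S < num_lanes S
     \<and> compat S \<subseteq> moves S \<times> moves S \<and> sym (compat S)"

text \<open>\<open>tx_ok \<alpha> m i\<close> and \<open>rx_ok \<alpha> m i\<close> are the values of the failure functions at
  \<open>(m, i)\<close>; \<^const>\<open>False\<close> means that the device fails in round \<open>m + 1\<close>.\<close>

record adversary =
  arrival :: "agent \<Rightarrow> nat \<times> lane \<times> lane"
  trans_env :: "((lane \<times> nat) \<times> (lane \<times> nat)) set"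
  tx_ok :: "nat \<Rightarrow> agent \<Rightarrow> bool"
  rx_ok :: "nat \<Rightarrow> agent \<Rightarrow> bool"

text \<open>The functions with domain \<open>agents S\<close> are taken to be extensional, so that equality of
  adversaries (and of the histories derived from them) ignores values outside \<open>agents S\<close>.\<close>

definition adversaries :: "'z setting_scheme \<Rightarrow> adversary set" where
  "adversaries S = {\<alpha>.
     arrival \<alpha> \<in> agents S \<rightarrow>\<^sub>E UNIV \<times> in_lanes S \<times> out_lanes S
     \<and> (\<forall>i\<in>agents S. \<forall>j\<in>agents S. i \<noteq> j \<and> fst (arrival \<alpha> i) = fst (arrival \<alpha> j)
          \<longrightarrow> fst (snd (arrival \<alpha> i)) \<noteq> fst (snd (arrival \<alpha> j)))
     \<and> trans_env \<alpha> \<subseteq> (in_lanes S \<times> UNIV) \<times> (in_lanes S \<times> UNIV)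
     \<and> (\<forall>l\<in>in_lanes S. \<forall>l'\<in>in_lanes S. ((l, 0), (l', 0)) \<in> trans_env \<alpha>)
     \<and> (\<forall>m. tx_ok \<alpha> m \<in> agents S \<rightarrow>\<^sub>E UNIV \<and> rx_ok \<alpha> m \<in> agents S \<rightarrow>\<^sub>E UNIV)}"

record env_state =
  adv :: adversary
  time :: nat
  queue :: "lane \<Rightarrow> agent list"
  passed :: "agent set"

text \<open>Values of \<open>pos\<close> and \<open>lane\<close>: \<open>Absent\<close> is bottom, \<open>Departed\<close> is top.\<close>

datatype 'a located = Absent | Here 'a | Departed

definition occupies :: "env_state \<Rightarrow> agent \<Rightarrow> lane \<Rightarrow> nat \<Rightarrow> bool" where
  "occupies s i l p \<longleftrightarrow> p < length (queue s l) \<and> queue s l ! p = i"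

definition queued :: "env_state \<Rightarrow> agent \<Rightarrow> bool" where
  "queued s i \<longleftrightarrow> (\<exists>l p. occupies s i l p)"

text \<open>Queues exist for incoming lanes only, which is encoded by the other lanes having
  empty queues.\<close>

definition env_states :: "'z setting_scheme \<Rightarrow> adversary set \<Rightarrow> env_state set" where
  "env_states S F = {s.
     adv s \<in> F
     \<and> (\<forall>l. set (queue s l) \<subseteq> agents S)
     \<and> (\<forall>l. l \<notin> in_lanes S \<longrightarrow> queue s l = [])
     \<and> passed s \<subseteq> agents S
     \<and> (\<forall>i l p l' p'. occupies s i l p \<and> occupies s i l' p' \<longrightarrow> l = l' \<and> p = p')
     \<and> (\<forall>i. queued s i \<longrightarrow> i \<notin> passed s)}"

definition pos_of :: "env_state \<Rightarrow> agent \<Rightarrow> nat located" where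
  "pos_of s i = (if queued s i then Here (THE p. \<exists>l. occupies s i l p)
                 else if i \<in> passed s then Departed else Absent)"

definition lane_of :: "env_state \<Rightarrow> agent \<Rightarrow> lane located" where
  "lane_of s i = (if queued s i then Here (THE l. \<exists>p. occupies s i l p)
                  else if i \<in> passed s then Departed else Absent)"

definition front_of :: "env_state \<Rightarrow> agent \<Rightarrow> bool" where
  "front_of s i \<longleftrightarrow> pos_of s i = Here 0"

definition intent_of :: "env_state \<Rightarrow> agent \<Rightarrow> lane" where
  "intent_of s i = snd (snd (arrival (adv s) i))"

record 'x sensor =
  front :: bool
  lane :: "lane located"
  intent :: lane
  extra :: 'x

datatype action = Go | Noop

type_synonym ('mem, 'x) local_state = "'mem \<times> 'x sensor"

text \<open>The interpretation of the atomic propositions is determined by the environment state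
  (it is given by \<^const>\<open>front_of\<close>, \<^const>\<open>lane_of\<close>, \<^const>\<open>intent_of\<close> and \<^const>\<open>pos_of\<close>),
  hence it is not a component of the record.\<close>

record ('mem, 'x, 'msg) icontext = setting +
  mem :: "agent \<Rightarrow> 'mem set"
  init_mem :: "agent \<Rightarrow> 'mem set"
  sensor_vals :: "agent \<Rightarrow> 'x sensor set"
  extra_reading :: "agent \<Rightarrow> env_state \<Rightarrow> 'x"
  msgs :: "agent \<Rightarrow> 'msg set"
  emit :: "agent \<Rightarrow> ('mem, 'x) local_state \<Rightarrow> action \<Rightarrow> 'x sensor \<Rightarrow> 'msg option"
  update :: "agent \<Rightarrow> ('mem, 'x) local_state \<Rightarrow> action \<Rightarrow> 'msg set \<Rightarrow> 'mem"
  model :: "adversary set"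

definition reading :: "('mem, 'x, 'msg) icontext \<Rightarrow> agent \<Rightarrow> env_state \<Rightarrow> 'x sensor" where
  "reading \<gamma> i s = \<lparr>front = front_of s i, lane = lane_of s i, intent = intent_of s i,
                     extra = extra_reading \<gamma> i s\<rparr>"

definition local_states :: "('mem, 'x, 'msg) icontext \<Rightarrow> agent \<Rightarrow> ('mem, 'x) local_state set" where
  "local_states \<gamma> i = mem \<gamma> i \<times> sensor_vals \<gamma> i"

definition intersection_context :: "('mem, 'x, 'msg) icontext \<Rightarrow> bool" where
  "intersection_context \<gamma> \<longleftrightarrow>
     setting_wf \<gamma>
     \<and> model \<gamma> \<subseteq> adversaries \<gamma>
     \<and> (\<forall>i\<in>agents \<gamma>.
          init_mem \<gamma> i \<subseteq> mem \<gamma> i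
          \<and> (\<forall>s\<in>env_states \<gamma> (model \<gamma>). reading \<gamma> i s \<in> sensor_vals \<gamma> i)
          \<and> (\<forall>s\<in>local_states \<gamma> i. \<forall>a. \<forall>v\<in>sensor_vals \<gamma> i.
               emit \<gamma> i s a v \<in> insert None (Some ` msgs \<gamma> i))
          \<and> (\<forall>s\<in>local_states \<gamma> i. \<forall>a. \<forall>B. B \<subseteq> (\<Union>j\<in>agents \<gamma>. msgs \<gamma> j)
               \<longrightarrow> update \<gamma> i s a B \<in> mem \<gamma> i))"

type_synonym ('mem, 'x) protocol = "agent \<Rightarrow> ('mem, 'x) local_state \<Rightarrow> action"

definition action_protocol ::
    "('mem, 'x, 'msg) icontext \<Rightarrow> ('mem, 'x) protocol \<Rightarrow> bool" where
  "action_protocol \<gamma> P \<longleftrightarrow>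
     (\<forall>i\<in>agents \<gamma>. \<forall>s\<in>local_states \<gamma> i. P i s = Go \<longrightarrow> front (snd s))"

record ('mem, 'x) global_state =
  env :: env_state
  locals :: "agent \<Rightarrow> ('mem, 'x) local_state"

type_synonym ('mem, 'x) run = "nat \<Rightarrow> ('mem, 'x) global_state"

definition initial_states ::
    "('mem, 'x, 'msg) icontext \<Rightarrow> ('mem, 'x) global_state set" where
  "initial_states \<gamma> = {\<lparr>env = s, locals = (\<lambda>i\<in>agents \<gamma>. (u i, reading \<gamma> i s))\<rparr> | s u.
     adv s \<in> model \<gamma> \<and> time s = 0 \<and> queue s = (\<lambda>_. []) \<and> passed s = {}
     \<and> (\<forall>i\<in>agents \<gamma>. u i \<in> init_mem \<gamma> i)}"

text \<open>For an adversary in \<^const>\<open>adversaries\<close> this list has at most one element.\<close>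

definition arrivals :: "'z setting_scheme \<Rightarrow> adversary \<Rightarrow> nat \<Rightarrow> lane \<Rightarrow> agent list" where
  "arrivals S \<alpha> t l = sorted_list_of_set {i \<in> agents S. \<exists>l'. arrival \<alpha> i = (t, l, l')}"

definition env_step ::
    "('mem, 'x, 'msg) icontext \<Rightarrow> ('mem, 'x) protocol \<Rightarrow> ('mem, 'x) global_state \<Rightarrow> env_state" where
  "env_step \<gamma> P g =
     (let s = env g; goes = (\<lambda>i. P i (locals g i) = Go) in
      \<lparr>adv = adv s,
       time = Suc (time s),
       queue = (\<lambda>l. (case queue s l of [] \<Rightarrow> [] | i # is \<Rightarrow> if goes i then is else i # is)
                     @ arrivals \<gamma> (adv s) (Suc (time s)) l),
       passed = passed s \<union> {i. (\<exists>l. occupies s i l 0) \<and> goes i}\<rparr>)"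

definition broadcast ::
    "('mem, 'x, 'msg) icontext \<Rightarrow> ('mem, 'x) protocol \<Rightarrow> ('mem, 'x) global_state
      \<Rightarrow> agent \<Rightarrow> 'msg option" where
  "broadcast \<gamma> P g j =
     emit \<gamma> j (locals g j) (P j (locals g j)) (reading \<gamma> j (env_step \<gamma> P g))"

definition received ::
    "('mem, 'x, 'msg) icontext \<Rightarrow> ('mem, 'x) protocol \<Rightarrow> ('mem, 'x) global_state
      \<Rightarrow> agent \<Rightarrow> 'msg set" where
  "received \<gamma> P g i =
     (let \<alpha> = adv (env g); m = time (env g); s' = env_step \<gamma> P g in
      if \<not> queued s' i \<or> \<not> rx_ok \<alpha> m i then {}
      else {b. \<exists>j\<in>agents \<gamma>. \<exists>l p l' p'. occupies s' j l p \<and> occupies s' i l' p'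
               \<and> ((l, p), (l', p')) \<in> trans_env \<alpha> \<and> tx_ok \<alpha> m j
               \<and> broadcast \<gamma> P g j = Some b})"

definition step ::
    "('mem, 'x, 'msg) icontext \<Rightarrow> ('mem, 'x) protocol \<Rightarrow> ('mem, 'x) global_state
      \<Rightarrow> ('mem, 'x) global_state" where
  "step \<gamma> P g =
     \<lparr>env = env_step \<gamma> P g,
      locals = (\<lambda>i\<in>agents \<gamma>. (update \<gamma> i (locals g i) (P i (locals g i)) (received \<gamma> P g i),
                              reading \<gamma> i (env_step \<gamma> P g)))\<rparr>"

definition runs ::
    "('mem, 'x, 'msg) icontext \<Rightarrow> ('mem, 'x) protocol \<Rightarrow> ('mem, 'x) run set" where
  "runs \<gamma> P = {r. r 0 \<in> initial_states \<gamma> \<and> (\<forall>m. r (Suc m) = step \<gamma> P (r m))}"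

abbreviation local_at :: "('mem, 'x) run \<Rightarrow> agent \<Rightarrow> nat \<Rightarrow> ('mem, 'x) local_state" where
  "local_at r i m \<equiv> locals (r m) i"

definition synchronous :: "('mem, 'x, 'msg) icontext \<Rightarrow> bool" where
  "synchronous \<gamma> \<longleftrightarrow>
     (\<forall>P. action_protocol \<gamma> P \<longrightarrow>
       (\<forall>r\<in>runs \<gamma> P. \<forall>r'\<in>runs \<gamma> P. \<forall>m m'. \<forall>i\<in>agents \<gamma>.
          local_at r i m = local_at r' i m' \<longrightarrow> m = m'))"

text \<open>Formulas are embedded shallowly as predicates on points \<open>(r, m)\<close>; an interpreted
  system is represented by its set \<open>R\<close> of runs.\<close>

type_synonym ('mem, 'x) fml = "('mem, 'x) run \<Rightarrow> nat \<Rightarrow> bool"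

definition Knows ::
    "('mem, 'x) run set \<Rightarrow> agent \<Rightarrow> ('mem, 'x) fml \<Rightarrow> ('mem, 'x) fml" where
  "Knows R i \<phi> = (\<lambda>r m. \<forall>r'\<in>R. \<forall>m'. local_at r' i m' = local_at r i m \<longrightarrow> \<phi> r' m')"

definition Next :: "('mem, 'x) fml \<Rightarrow> ('mem, 'x) fml" where
  "Next \<phi> = (\<lambda>r m. \<phi> r (m + 1))"

definition valid_in :: "('mem, 'x) run set \<Rightarrow> ('mem, 'x) fml \<Rightarrow> bool" where
  "valid_in R \<phi> \<longleftrightarrow> (\<forall>r\<in>R. \<forall>m. \<phi> r m)"

definition Front :: "agent \<Rightarrow> ('mem, 'x) fml" where
  "Front i = (\<lambda>r m. front_of (env (r m)) i)"

definition going :: "agent \<Rightarrow> ('mem, 'x) fml" where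
  "going i = (\<lambda>r m. Front i r m \<and> Next (\<lambda>r m. \<not> Front i r m) r m)"

definition moves_compatible ::
    "('mem, 'x, 'msg) icontext \<Rightarrow> agent \<Rightarrow> agent \<Rightarrow> ('mem, 'x) fml" where
  "moves_compatible \<gamma> i j = (\<lambda>r m. \<exists>l l'.
     lane_of (env (r m)) i = Here l \<and> lane_of (env (r m)) j = Here l'
     \<and> ((l, intent_of (env (r m)) i), (l', intent_of (env (r m)) j)) \<in> compat \<gamma>)"

definition validity :: "('mem, 'x, 'msg) icontext \<Rightarrow> ('mem, 'x) protocol \<Rightarrow> bool" where
  "validity \<gamma> P \<longleftrightarrow>
     (\<forall>i\<in>agents \<gamma>. valid_in (runs \<gamma> P) (\<lambda>r m. going i r m \<longrightarrow> Front i r m))"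

definition safety :: "('mem, 'x, 'msg) icontext \<Rightarrow> ('mem, 'x) protocol \<Rightarrow> bool" where
  "safety \<gamma> P \<longleftrightarrow>
     (\<forall>i\<in>agents \<gamma>. \<forall>j\<in>agents \<gamma>. i \<noteq> j \<longrightarrow>
        valid_in (runs \<gamma> P) (\<lambda>r m. going i r m \<and> going j r m \<longrightarrow> moves_compatible \<gamma> i j r m))"

record adv_slice =
  slice_arrivals :: "(agent \<times> lane \<times> lane) set"
  slice_trans :: "((lane \<times> nat) \<times> (lane \<times> nat)) set"
  slice_rx :: "agent \<Rightarrow> bool"
  slice_tx :: "agent \<Rightarrow> bool"

definition slice :: "'z setting_scheme \<Rightarrow> adversary \<Rightarrow> nat \<Rightarrow> adv_slice" where
  "slice S \<alpha> m =
     \<lparr>slice_arrivals = {(i, l, l'). i \<in> agents S \<and> arrival \<alpha> i = (m + 1, l, l')},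
      slice_trans = trans_env \<alpha>,
      slice_rx = rx_ok \<alpha> m,
      slice_tx = tx_ok \<alpha> m\<rparr>"

type_synonym history = "adv_slice list"
type_synonym policy = "history \<Rightarrow> move set"

definition history :: "'z setting_scheme \<Rightarrow> adversary \<Rightarrow> nat \<Rightarrow> history" where
  "history S \<alpha> m = map (slice S \<alpha>) [0..<m]"

definition histories :: "('mem, 'x, 'msg) icontext \<Rightarrow> history set" where
  "histories \<gamma> = {history \<gamma> \<alpha> m | \<alpha> m. \<alpha> \<in> model \<gamma>}"

definition run_history ::
    "('mem, 'x, 'msg) icontext \<Rightarrow> ('mem, 'x) run \<Rightarrow> nat \<Rightarrow> history" where
  "run_history \<gamma> r m = history \<gamma> (adv (env (r 0))) m"

definition intersection_policy :: "('mem, 'x, 'msg) icontext \<Rightarrow> policy \<Rightarrow> bool" where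
  "intersection_policy \<gamma> \<sigma> \<longleftrightarrow> (\<forall>h\<in>histories \<gamma>. \<sigma> h \<subseteq> moves \<gamma>)"

definition conflict_free :: "('mem, 'x, 'msg) icontext \<Rightarrow> policy \<Rightarrow> bool" where
  "conflict_free \<gamma> \<sigma> \<longleftrightarrow>
     (\<forall>h\<in>histories \<gamma>. \<forall>x\<in>\<sigma> h. \<forall>y\<in>\<sigma> h. x \<noteq> y \<longrightarrow> (x, y) \<in> compat \<gamma>)"

definition fair :: "('mem, 'x, 'msg) icontext \<Rightarrow> policy \<Rightarrow> bool" where
  "fair \<gamma> \<sigma> \<longleftrightarrow>
     (\<forall>\<alpha>\<in>model \<gamma>. \<forall>x\<in>moves \<gamma>. \<forall>m. \<exists>m'\<ge>m. x \<in> \<sigma> (history \<gamma> \<alpha> m'))"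

definition correct_policy :: "('mem, 'x, 'msg) icontext \<Rightarrow> policy \<Rightarrow> bool" where
  "correct_policy \<gamma> \<sigma> \<longleftrightarrow> conflict_free \<gamma> \<sigma> \<and> fair \<gamma> \<sigma>"

text \<open>The program in which agent \<open>i\<close> runs ``if \<open>K\<^sub>i \<phi>\<^sub>i\<close> then go else noop'' is represented
  by the family \<open>\<phi>\<close> of tests.\<close>

type_synonym ('mem, 'x) kb_program = "agent \<Rightarrow> ('mem, 'x) fml"

definition implements ::
    "('mem, 'x, 'msg) icontext \<Rightarrow> ('mem, 'x) protocol \<Rightarrow> ('mem, 'x) kb_program \<Rightarrow> bool" where
  "implements \<gamma> P \<phi> \<longleftrightarrow>
     action_protocol \<gamma> P
     \<and> (\<forall>r\<in>runs \<gamma> P. \<forall>m. \<forall>i\<in>agents \<gamma>.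
          P i (local_at r i m) = Go \<longleftrightarrow> Knows (runs \<gamma> P) i (\<phi> i) r m)"

definition move_in_policy ::
    "('mem, 'x, 'msg) icontext \<Rightarrow> policy \<Rightarrow> agent \<Rightarrow> ('mem, 'x) fml" where
  "move_in_policy \<gamma> \<sigma> i = (\<lambda>r m. \<exists>l.
     lane_of (env (r m)) i = Here l \<and> (l, intent_of (env (r m)) i) \<in> \<sigma> (run_history \<gamma> r m))"

definition policy_program ::
    "('mem, 'x, 'msg) icontext \<Rightarrow> policy \<Rightarrow> ('mem, 'x) kb_program" where
  "policy_program \<gamma> \<sigma> i = (\<lambda>r m. Front i r m \<and> move_in_policy \<gamma> \<sigma> i r m)"

definition reachable ::
    "('mem, 'x, 'msg) icontext \<Rightarrow> ('mem, 'x) protocol \<Rightarrow> agent \<Rightarrow> ('mem, 'x) local_state set" where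
  "reachable \<gamma> P i = {local_at r i m | r m. r \<in> runs \<gamma> P}"

definition behaviorally_equal ::
    "('mem, 'x, 'msg) icontext \<Rightarrow> ('mem, 'x) protocol \<Rightarrow> ('mem, 'x) protocol \<Rightarrow> bool" where
  "behaviorally_equal \<gamma> P Q \<longleftrightarrow>
     (\<forall>i\<in>agents \<gamma>. reachable \<gamma> P i = reachable \<gamma> Q i
        \<and> (\<forall>s\<in>reachable \<gamma> P i. P i s = Q i s))"

end

theory Submission
  imports Defs
begin

text \<open>In a synchronous context the knowledge test at time \<open>m\<close> only depends on the global states
  reachable at time \<open>m\<close>, hence on the actions taken before time \<open>m\<close>. So the sets of states
  reachable at the successive times, together with the actions taken there, are determined by
  recursion on time. Synchrony also makes the local states occurring at different times distinct, so
  the actions can be merged into a single protocol. For Safety, two agents that leave at the same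
  time both know that their moves are in the policy's current set, and the two moves differ because
  they start from different lanes.\<close>

section \<open>Reachable global states, sorted by time\<close>

definition states_at ::
    "('mem, 'x, 'msg) icontext \<Rightarrow> ('mem, 'x) protocol \<Rightarrow> nat \<Rightarrow> ('mem, 'x) global_state set" where
  "states_at \<gamma> P m = {r m | r. r \<in> runs \<gamma> P}"

text \<open>Steps are deterministic and always possible, so iterating \<open>step\<close> extends
  any initial state to a run.\<close>

lemma states_at_0: "states_at \<gamma> P 0 = initial_states \<gamma>"
proof
  show "initial_states \<gamma> \<subseteq> states_at \<gamma> P 0"
  proof
    fix g assume "g \<in> initial_states \<gamma>"
    then have "(\<lambda>n. (step \<gamma> P ^^ n) g) \<in> runs \<gamma> P"
      by (simp add: runs_def)
    then show "g \<in> states_at \<gamma> P 0"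
      unfolding states_at_def by (intro CollectI exI[of _ "\<lambda>n. (step \<gamma> P ^^ n) g"]) simp
  qed
qed (auto simp: states_at_def runs_def)

lemma states_at_Suc: "states_at \<gamma> P (Suc m) = step \<gamma> P ` states_at \<gamma> P m"
proof -
  have "r (Suc m) = step \<gamma> P (r m)" if "r \<in> runs \<gamma> P" for r
    using that by (simp add: runs_def)
  then show ?thesis
    unfolding states_at_def by (fastforce simp: image_iff)
qed

lemma adv_run:
  assumes "r \<in> runs \<gamma> P"
  shows "adv (env (r m)) = adv (env (r 0))"
proof (induction m)
  case (Suc m)
  then show ?case
    using assms by (simp add: runs_def step_def env_step_def Let_def)
qed simp

section \<open>Queues and positions\<close>

lemma set_arrivals: "set (arrivals S \<alpha> t l) \<subseteq> {i \<in> agents S. \<exists>l'. arrival \<alpha> i = (t, l, l')}"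
proof (cases "finite {i \<in> agents S. \<exists>l'. arrival \<alpha> i = (t, l, l')}")
  \<comment> \<open>\<open>sorted_list_of_set\<close> returns the empty list on an infinite set;
    with \<open>S\<close> and \<open>\<alpha>\<close> arbitrary, this is why only an inclusion is
    claimed.\<close>
  case False
  then show ?thesis by (simp add: arrivals_def sorted_list_of_set.fold_insort_key.infinite)
qed (simp add: arrivals_def)

lemma distinct_arrivals: "distinct (arrivals S \<alpha> t l)"
  by (simp add: arrivals_def)

text \<open>Since an agent arrives only once, recording the arrival lane and a bound on the arrival time
  of every queued agent makes the single occupancy of queue positions inductive.\<close>

definition queues_ok :: "('mem, 'x, 'msg) icontext \<Rightarrow> nat \<Rightarrow> env_state \<Rightarrow> bool" where
  "queues_ok \<gamma> m s \<longleftrightarrow> adv s \<in> model \<gamma> \<and> time s = m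
     \<and> (\<forall>l. distinct (queue s l)
          \<and> set (queue s l) \<subseteq> {i \<in> agents \<gamma>. \<exists>t\<le>m. \<exists>l'. arrival (adv s) i = (t, l, l')})"

lemma queues_ok_env_step:
  assumes "queues_ok \<gamma> m (env g)"
  shows "queues_ok \<gamma> (Suc m) (env_step \<gamma> P g)"
proof -
  let ?s = "env g"
  \<comment> \<open>The queue after departures and before arrivals.\<close>
  define q where "q l = (case queue ?s l of [] \<Rightarrow> []
    | i # is \<Rightarrow> if P i (locals g i) = Go then is else i # is)" for l
  have q: "distinct (q l)" "set (q l) \<subseteq> set (queue ?s l)" for l
  proof -
    have "distinct (queue ?s l)" using assms by (simp add: queues_ok_def)
    then show "distinct (q l)" by (auto simp: q_def split: list.splits)
    show "set (q l) \<subseteq> set (queue ?s l)" by (cases "queue ?s l") (auto simp: q_def)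
  qed
  have old: "\<exists>t\<le>m. \<exists>l'. arrival (adv ?s) i = (t, l, l')" "i \<in> agents \<gamma>" if "i \<in> set (q l)" for i l
    using that q(2)[of l] assms unfolding queues_ok_def by blast+
  have new: "\<exists>l'. arrival (adv ?s) i = (Suc m, l, l')" "i \<in> agents \<gamma>"
    if "i \<in> set (arrivals \<gamma> (adv ?s) (Suc m) l)" for i l
    using that set_arrivals[of \<gamma> "adv ?s" "Suc m" l] by auto
  \<comment> \<open>The remaining agents arrived by time \<open>m\<close>, the new ones at
    \<open>Suc m\<close>, and \<open>arrival\<close> gives each agent one time.\<close>
  have "set (q l) \<inter> set (arrivals \<gamma> (adv ?s) (Suc m) l) = {}" for l
    using old(1) new(1) by fastforce
  then have "distinct (q l @ arrivals \<gamma> (adv ?s) (Suc m) l)" for l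
    using q(1) distinct_arrivals by auto
  moreover have "\<exists>t\<le>Suc m. \<exists>l'. arrival (adv ?s) i = (t, l, l')" "i \<in> agents \<gamma>"
    if "i \<in> set (q l @ arrivals \<gamma> (adv ?s) (Suc m) l)" for i l
    using that old[of i l] new[of i l] le_SucI by auto
  moreover have "time ?s = m" "adv ?s \<in> model \<gamma>"
    using assms by (auto simp: queues_ok_def)
  moreover have "env_step \<gamma> P g = \<lparr>adv = adv ?s, time = Suc (time ?s),
      queue = (\<lambda>l. q l @ arrivals \<gamma> (adv ?s) (Suc (time ?s)) l),
      passed = passed ?s \<union> {i. (\<exists>l. occupies ?s i l 0) \<and> P i (locals g i) = Go}\<rparr>"
    by (simp add: env_step_def Let_def q_def)
  ultimately show ?thesis
    unfolding queues_ok_def by (simp add: subset_iff)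
qed

lemma queues_ok_states_at:
  "g \<in> states_at \<gamma> P m \<Longrightarrow> queues_ok \<gamma> m (env g)"
proof (induction m arbitrary: g)
  case 0
  then show ?case by (auto simp: states_at_0 initial_states_def queues_ok_def)
next
  case (Suc m)
  then show ?case by (force simp: states_at_Suc step_def dest: queues_ok_env_step)
qed

lemma occupies_agent:
  assumes "queues_ok \<gamma> m s" "occupies s i l p"
  shows "i \<in> agents \<gamma>"
proof -
  have "i \<in> set (queue s l)" using assms(2) by (auto simp: occupies_def)
  then show ?thesis using assms(1) by (auto simp: queues_ok_def)
qed

text \<open>The arrival lane pins down the queue, and distinctness of that queue pins down the
  position.\<close>

lemma occupies_unique:
  assumes "queues_ok \<gamma> m s" "occupies s i l p" "occupies s i l' p'"
  shows "l = l' \<and> p = p'"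
proof -
  have "i \<in> set (queue s l)" "i \<in> set (queue s l')"
    using assms(2,3) unfolding occupies_def by (metis nth_mem)+
  then obtain t t' k k' where "arrival (adv s) i = (t, l, k)" "arrival (adv s) i = (t', l', k')"
    using assms(1) unfolding queues_ok_def by blast
  then have "l = l'" by simp
  moreover have "distinct (queue s l)" using assms(1) by (simp add: queues_ok_def)
  ultimately show ?thesis
    using assms(2,3) by (auto simp: occupies_def nth_eq_iff_index_eq)
qed

text \<open>Uniqueness of the occupied place evaluates the definite descriptions in
  \<open>pos_of\<close> and \<open>lane_of\<close>.\<close>

lemma occupies_pos_lane:
  assumes "queues_ok \<gamma> m s" "occupies s i l p"
  shows "pos_of s i = Here p" "lane_of s i = Here l"
proof -
  have "(THE p. \<exists>l. occupies s i l p) = p" "(THE l. \<exists>p. occupies s i l p) = l"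
    using assms by (auto intro!: the_equality dest: occupies_unique)
  then show "pos_of s i = Here p" "lane_of s i = Here l"
    using assms by (auto simp: pos_of_def lane_of_def queued_def)
qed

lemma front_of_iff:
  assumes "queues_ok \<gamma> m s"
  shows "front_of s i \<longleftrightarrow> (\<exists>l. occupies s i l 0)"
proof
  assume front: "front_of s i"
  then have "queued s i" by (auto simp: front_of_def pos_of_def split: if_splits)
  then obtain l p where "occupies s i l p" by (auto simp: queued_def)
  then show "\<exists>l. occupies s i l 0"
    using occupies_pos_lane[OF assms, of i l p] front by (auto simp: front_of_def)
qed (use occupies_pos_lane(1)[OF assms] in \<open>auto simp: front_of_def\<close>)

section \<open>Effect of actions on a step\<close>

lemma env_step_keeps_front:
  assumes "occupies (env g) i l 0" "P i (locals g i) \<noteq> Go"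
  shows "occupies (env_step \<gamma> P g) i l 0"
  using assms by (cases "queue (env g) l") (auto simp: occupies_def env_step_def Let_def)

text \<open>A step consults the protocol only at the current local states of agents: departures
  concern queue heads, which \<open>queues_ok\<close> places in \<open>agents \<gamma>\<close>, and
  messages are collected from agents only.\<close>

lemma step_cong:
  assumes "queues_ok \<gamma> m (env g)"
    and "\<And>i. i \<in> agents \<gamma> \<Longrightarrow> P i (locals g i) = Q i (locals g i)"
  shows "step \<gamma> P g = step \<gamma> Q g"
proof -
  have head: "P i (locals g i) = Q i (locals g i)" if "queue (env g) l = i # is" for i "is" l
    using that occupies_agent[OF assms(1), of i l 0] assms(2) by (simp add: occupies_def)
  have "passed (env_step \<gamma> P g) = passed (env_step \<gamma> Q g)"
    using occupies_agent[OF assms(1)] assms(2) by (auto simp: env_step_def Let_def)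
  moreover have "queue (env_step \<gamma> P g) = queue (env_step \<gamma> Q g)"
    by (auto simp: env_step_def Let_def head split: list.splits)
  ultimately have env: "env_step \<gamma> P g = env_step \<gamma> Q g"
    by (simp add: env_step_def Let_def)
  have "received \<gamma> P g i = received \<gamma> Q g i" for i
    using assms(2) by (auto simp: received_def Let_def env broadcast_def)
  then show ?thesis
    using assms(2) by (auto simp: step_def env)
qed

section \<open>The knowledge test within one time slice\<close>

definition policy_test ::
    "('mem, 'x, 'msg) icontext \<Rightarrow> policy \<Rightarrow> nat \<Rightarrow> agent \<Rightarrow> ('mem, 'x) global_state \<Rightarrow> bool" where
  "policy_test \<gamma> \<sigma> m i g \<longleftrightarrow> front_of (env g) i \<and> (\<exists>l. lane_of (env g) i = Here l
     \<and> (l, intent_of (env g) i) \<in> \<sigma> (history \<gamma> (adv (env g)) m))"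

text \<open>The adversary is constant along a run, so the history can be read off the current global
  state and the time.\<close>

lemma policy_program_iff:
  assumes "r \<in> runs \<gamma> P"
  shows "policy_program \<gamma> \<sigma> i r m \<longleftrightarrow> policy_test \<gamma> \<sigma> m i (r m)"
  by (simp add: policy_program_def policy_test_def Front_def move_in_policy_def run_history_def
      adv_run[OF assms, of m])

lemma synchronousD:
  assumes "synchronous \<gamma>" "action_protocol \<gamma> P" "i \<in> agents \<gamma>"
    and "g \<in> states_at \<gamma> P m" "g' \<in> states_at \<gamma> P m'" "locals g i = locals g' i"
  shows "m = m'"
  using assms unfolding synchronous_def states_at_def by blast

text \<open>Synchrony confines the points indistinguishable from \<open>(r, m)\<close> to time
  \<open>m\<close>.\<close>

lemma Knows_policy_program_iff:
  assumes "synchronous \<gamma>" "action_protocol \<gamma> P" "r \<in> runs \<gamma> P" "i \<in> agents \<gamma>"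
  shows "Knows (runs \<gamma> P) i (policy_program \<gamma> \<sigma> i) r m \<longleftrightarrow>
    (\<forall>g\<in>states_at \<gamma> P m. locals g i = local_at r i m \<longrightarrow> policy_test \<gamma> \<sigma> m i g)"
proof -
  have "m' = m" if "r' \<in> runs \<gamma> P" "local_at r' i m' = local_at r i m" for r' m'
    using assms that unfolding synchronous_def by blast
  then show ?thesis
    unfolding Knows_def states_at_def using policy_program_iff by blast
qed

text \<open>The existence conjunct excludes vacuous knowledge: otherwise \<open>Go\<close> would be
  chosen at every local state of an agent absent from \<open>G\<close>, and actions for different
  times could not be merged.\<close>

definition knowledge_action ::
    "('mem, 'x, 'msg) icontext \<Rightarrow> policy \<Rightarrow> nat \<Rightarrow> ('mem, 'x) global_state set
      \<Rightarrow> ('mem, 'x) protocol" where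
  "knowledge_action \<gamma> \<sigma> m G i s =
     (if i \<in> agents \<gamma> \<and> (\<exists>g\<in>G. locals g i = s)
         \<and> (\<forall>g\<in>G. locals g i = s \<longrightarrow> policy_test \<gamma> \<sigma> m i g)
      then Go else Noop)"

lemma knowledge_action_GoE:
  assumes "knowledge_action \<gamma> \<sigma> m G i s = Go"
  obtains g where "i \<in> agents \<gamma>" "g \<in> G" "locals g i = s" "policy_test \<gamma> \<sigma> m i g"
  using assms by (auto simp: knowledge_action_def split: if_splits)

section \<open>Recursion on time and uniqueness\<close>

primrec kb_states ::
    "('mem, 'x, 'msg) icontext \<Rightarrow> policy \<Rightarrow> nat \<Rightarrow> ('mem, 'x) global_state set" where
  "kb_states \<gamma> \<sigma> 0 = initial_states \<gamma>"
| "kb_states \<gamma> \<sigma> (Suc m) =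
     step \<gamma> (knowledge_action \<gamma> \<sigma> m (kb_states \<gamma> \<sigma> m)) ` kb_states \<gamma> \<sigma> m"

abbreviation kb_action ::
    "('mem, 'x, 'msg) icontext \<Rightarrow> policy \<Rightarrow> nat \<Rightarrow> ('mem, 'x) protocol" where
  "kb_action \<gamma> \<sigma> m \<equiv> knowledge_action \<gamma> \<sigma> m (kb_states \<gamma> \<sigma> m)"

text \<open>This recasts implementation as a fixed-point condition: the actions at time
  \<open>m\<close> are computed from the states at time \<open>m\<close>, which the protocol itself
  generates by its earlier actions.\<close>

lemma implements_iff:
  assumes "synchronous \<gamma>"
  shows "implements \<gamma> P (policy_program \<gamma> \<sigma>) \<longleftrightarrow> action_protocol \<gamma> P
    \<and> (\<forall>m. \<forall>g\<in>states_at \<gamma> P m. \<forall>i\<in>agents \<gamma>.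
         P i (locals g i) = knowledge_action \<gamma> \<sigma> m (states_at \<gamma> P m) i (locals g i))"
    (is "_ \<longleftrightarrow> _ \<and> ?R")
proof (cases "action_protocol \<gamma> P")
  case True
  have "(P i (local_at r i m) = Go \<longleftrightarrow> Knows (runs \<gamma> P) i (policy_program \<gamma> \<sigma> i) r m) \<longleftrightarrow>
      P i (local_at r i m) = knowledge_action \<gamma> \<sigma> m (states_at \<gamma> P m) i (local_at r i m)"
    if "r \<in> runs \<gamma> P" "i \<in> agents \<gamma>" for r m i
  proof -
    \<comment> \<open>The point itself witnesses the existence conjunct of
      \<open>knowledge_action\<close>.\<close>
    have "\<exists>g\<in>states_at \<gamma> P m. locals g i = local_at r i m"
      using that(1) by (auto simp: states_at_def)
    with that(2) show ?thesis
      unfolding Knows_policy_program_iff[OF assms True that] knowledge_action_def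
      by (cases "P i (local_at r i m)") auto
  qed
  moreover have "?R \<longleftrightarrow> (\<forall>r\<in>runs \<gamma> P. \<forall>m. \<forall>i\<in>agents \<gamma>. P i (local_at r i m) =
      knowledge_action \<gamma> \<sigma> m (states_at \<gamma> P m) i (local_at r i m))"
    unfolding states_at_def by blast
  ultimately show ?thesis
    unfolding implements_def using True by auto
qed (simp add: implements_def)

text \<open>Equal states at time \<open>m\<close> force equal knowledge actions there, hence by
  \<open>step_cong\<close> equal successors.\<close>

lemma implements_states_at:
  assumes "synchronous \<gamma>" "implements \<gamma> P (policy_program \<gamma> \<sigma>)"
  shows "states_at \<gamma> P m = kb_states \<gamma> \<sigma> m"
proof (induction m)
  case (Suc m)
  have "step \<gamma> P g = step \<gamma> (kb_action \<gamma> \<sigma> m) g" if "g \<in> states_at \<gamma> P m" for g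
  proof (rule step_cong[of _ m])
    show "P i (locals g i) = kb_action \<gamma> \<sigma> m i (locals g i)" if "i \<in> agents \<gamma>" for i
      using assms(2) that \<open>g \<in> states_at \<gamma> P m\<close> Suc by (metis implements_iff[OF assms(1)])
  qed (rule queues_ok_states_at[OF that])
  then show ?case using Suc by (simp add: states_at_Suc)
qed (simp add: states_at_0)

lemma implements_action:
  assumes "synchronous \<gamma>" "implements \<gamma> P (policy_program \<gamma> \<sigma>)"
    and "g \<in> kb_states \<gamma> \<sigma> m" "i \<in> agents \<gamma>"
  shows "P i (locals g i) = kb_action \<gamma> \<sigma> m i (locals g i)"
  using assms(2-4) implements_states_at[OF assms(1,2), of m]
  by (metis implements_iff[OF assms(1)])

text \<open>The right-hand side does not mention \<open>P\<close>, so all implementations reach the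
  same local states.\<close>

lemma implements_reachable:
  assumes "synchronous \<gamma>" "implements \<gamma> P (policy_program \<gamma> \<sigma>)"
  shows "reachable \<gamma> P i = (\<Union>m. (\<lambda>g. locals g i) ` kb_states \<gamma> \<sigma> m)"
  unfolding implements_states_at[OF assms, symmetric]
  by (auto simp: reachable_def states_at_def)

lemma implements_behaviorally_equal:
  assumes "synchronous \<gamma>"
    and "implements \<gamma> P (policy_program \<gamma> \<sigma>)" "implements \<gamma> Q (policy_program \<gamma> \<sigma>)"
  shows "behaviorally_equal \<gamma> P Q"
  unfolding behaviorally_equal_def implements_reachable[OF assms(1,2)]
    implements_reachable[OF assms(1,3)]
  using implements_action[OF assms(1,2)] implements_action[OF assms(1,3)] by simp

section \<open>Existence by merging the actions of all times\<close>

definition merged ::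
    "('mem, 'x, 'msg) icontext \<Rightarrow> policy \<Rightarrow> nat set \<Rightarrow> ('mem, 'x) protocol" where
  "merged \<gamma> \<sigma> X i s = (if \<exists>m\<in>X. kb_action \<gamma> \<sigma> m i s = Go then Go else Noop)"

definition times_distinct :: "('mem, 'x, 'msg) icontext \<Rightarrow> policy \<Rightarrow> nat set \<Rightarrow> bool" where
  "times_distinct \<gamma> \<sigma> X \<longleftrightarrow> (\<forall>m\<in>X. \<forall>m'\<in>X. \<forall>g\<in>kb_states \<gamma> \<sigma> m. \<forall>g'\<in>kb_states \<gamma> \<sigma> m'.
     \<forall>i\<in>agents \<gamma>. locals g i = locals g' i \<longrightarrow> m = m')"

lemma times_distinctD:
  assumes "times_distinct \<gamma> \<sigma> X" "m \<in> X" "m' \<in> X" "g \<in> kb_states \<gamma> \<sigma> m"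
    and "g' \<in> kb_states \<gamma> \<sigma> m'" "i \<in> agents \<gamma>" "locals g i = locals g' i"
  shows "m = m'"
  using assms(1)[unfolded times_distinct_def, rule_format, OF assms(2-7)] .

lemma kb_states_sensor:
  assumes "g \<in> kb_states \<gamma> \<sigma> m" "i \<in> agents \<gamma>"
  shows "snd (locals g i) = reading \<gamma> i (env g)"
  using assms by (cases m) (auto simp: initial_states_def step_def)

text \<open>Every \<open>Go\<close> comes from a state in some \<open>kb_states\<close> whose sensor
  shows the agent at the front. This is available before times are known to be distinct, so
  synchrony can be applied inside the induction of \<open>times_distinct_lessThan\<close>.\<close>

lemma action_protocol_merged: "action_protocol \<gamma> (merged \<gamma> \<sigma> X)"
proof -
  have "front (snd s)" if "kb_action \<gamma> \<sigma> m i s = Go" for m i s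
  proof -
    from that obtain g where
      "i \<in> agents \<gamma>" "g \<in> kb_states \<gamma> \<sigma> m" "locals g i = s" "policy_test \<gamma> \<sigma> m i g"
      by (rule knowledge_action_GoE)
    then show ?thesis
      using kb_states_sensor[of g \<gamma> \<sigma> m i] by (auto simp: reading_def policy_test_def)
  qed
  then show ?thesis by (auto simp: action_protocol_def merged_def split: if_splits)
qed

lemma merged_eq:
  assumes "times_distinct \<gamma> \<sigma> X" "m \<in> X" "g \<in> kb_states \<gamma> \<sigma> m"
  shows "merged \<gamma> \<sigma> X i (locals g i) = kb_action \<gamma> \<sigma> m i (locals g i)"
proof (cases "kb_action \<gamma> \<sigma> m i (locals g i)")
  case Go
  then show ?thesis using assms(2) by (auto simp: merged_def)
next
  case Noop
  \<comment> \<open>A \<open>Go\<close> contributed by time \<open>m'\<close> requires this local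
    state to occur at \<open>m'\<close>, so \<open>m'\<close> must be \<open>m\<close>.\<close>
  have False if "m' \<in> X" "kb_action \<gamma> \<sigma> m' i (locals g i) = Go" for m'
  proof -
    from that(2) obtain g' where
      g': "i \<in> agents \<gamma>" "g' \<in> kb_states \<gamma> \<sigma> m'" "locals g' i = locals g i"
      by (rule knowledge_action_GoE)
    have "m' = m"
      by (rule times_distinctD[OF assms(1) that(1) assms(2) g'(2) assms(3) g'(1,3)])
    then show False using that(2) Noop by simp
  qed
  then have "\<not> (\<exists>m'\<in>X. kb_action \<gamma> \<sigma> m' i (locals g i) = Go)"
    by (intro notI) (elim bexE)
  then have "merged \<gamma> \<sigma> X i (locals g i) = Noop"
    by (simp only: merged_def if_False)
  then show ?thesis by (simp only: Noop)
qed

text \<open>Only actions before time \<open>m\<close> shape the states at time \<open>m\<close>,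
  hence the bound \<open>{..<m}\<close>.\<close>

lemma states_at_merged:
  assumes "times_distinct \<gamma> \<sigma> X" "{..<m} \<subseteq> X"
  shows "states_at \<gamma> (merged \<gamma> \<sigma> X) m = kb_states \<gamma> \<sigma> m"
  using assms(2)
proof (induction m)
  case (Suc m)
  have "{..<m} \<subseteq> X" "m \<in> X"
    using Suc.prems by auto
  with Suc.IH have IH: "states_at \<gamma> (merged \<gamma> \<sigma> X) m = kb_states \<gamma> \<sigma> m" and "m \<in> X"
    by simp_all
  then have "step \<gamma> (merged \<gamma> \<sigma> X) g = step \<gamma> (kb_action \<gamma> \<sigma> m) g"
    if "g \<in> kb_states \<gamma> \<sigma> m" for g
    using that merged_eq[OF assms(1)]
    by (intro step_cong[of _ m] queues_ok_states_at[of g \<gamma> "merged \<gamma> \<sigma> X" m]) auto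
  then show ?case using IH by (simp add: states_at_Suc)
qed (simp add: states_at_0)

text \<open>Synchrony speaks of the runs of a single action protocol, while merging correctly into
  one relies on distinct times. Induction breaks the circle: the protocol merged over the times
  below \<open>n\<close> already reaches the right states up to and including time \<open>n\<close>,
  so synchrony for it also separates time \<open>n\<close> from the earlier ones.\<close>

lemma times_distinct_lessThan:
  assumes "synchronous \<gamma>"
  shows "times_distinct \<gamma> \<sigma> {..<n}"
proof (induction n)
  case (Suc n)
  have eq: "states_at \<gamma> (merged \<gamma> \<sigma> {..<n}) m = kb_states \<gamma> \<sigma> m" if "m < Suc n" for m
    using that by (intro states_at_merged[OF Suc]) auto
  show ?case
    unfolding times_distinct_def
  proof (intro ballI impI)
    fix m m' g g' i
    assume "m \<in> {..<Suc n}" "m' \<in> {..<Suc n}" "g \<in> kb_states \<gamma> \<sigma> m" "g' \<in> kb_states \<gamma> \<sigma> m'"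
      and i: "i \<in> agents \<gamma>" "locals g i = locals g' i"
    then have "g \<in> states_at \<gamma> (merged \<gamma> \<sigma> {..<n}) m" "g' \<in> states_at \<gamma> (merged \<gamma> \<sigma> {..<n}) m'"
      by (simp_all add: eq)
    then show "m = m'"
      using i by (intro synchronousD[OF assms action_protocol_merged])
  qed
qed (simp add: times_distinct_def)

lemma implements_merged:
  assumes "synchronous \<gamma>"
  shows "implements \<gamma> (merged \<gamma> \<sigma> UNIV) (policy_program \<gamma> \<sigma>)"
proof -
  have distinct: "times_distinct \<gamma> \<sigma> UNIV"
    unfolding times_distinct_def
  proof (intro ballI impI)
    fix m m' g g' i
    assume "g \<in> kb_states \<gamma> \<sigma> m" "g' \<in> kb_states \<gamma> \<sigma> m'" "i \<in> agents \<gamma>" "locals g i = locals g' i"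
    then show "m = m'"
      \<comment> \<open>Any two times lie in a common finite initial segment.\<close>
      by (intro times_distinctD[OF times_distinct_lessThan[OF assms, of \<sigma> "Suc (max m m')"],
            of m m' g g' i]) auto
  qed
  show ?thesis
    unfolding implements_iff[OF assms] states_at_merged[OF distinct subset_UNIV]
    using action_protocol_merged[of \<gamma> \<sigma> UNIV] merged_eq[OF distinct] by simp
qed

section \<open>Safety and Validity\<close>

lemma going_policy_test:
  assumes "synchronous \<gamma>" "implements \<gamma> P (policy_program \<gamma> \<sigma>)"
    and "r \<in> runs \<gamma> P" "i \<in> agents \<gamma>" "going i r m"
  shows "policy_test \<gamma> \<sigma> m i (r m)"
proof -
  have rm: "r m \<in> states_at \<gamma> P m" and "r (Suc m) \<in> states_at \<gamma> P (Suc m)"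
    using assms(3) by (auto simp: states_at_def)
  then have ok: "queues_ok \<gamma> m (env (r m))" "queues_ok \<gamma> (Suc m) (env (r (Suc m)))"
    by (auto intro: queues_ok_states_at)
  have next_env: "env (r (Suc m)) = env_step \<gamma> P (r m)"
    using assms(3) by (simp add: runs_def step_def)
  \<comment> \<open>Arrivals join at the back, so an agent at the front that does not go stays at
    the front.\<close>
  have "P i (local_at r i m) = Go"
    using assms(5) env_step_keeps_front[of "r m" i _ P \<gamma>]
    by (auto simp: going_def Front_def Next_def front_of_iff[OF ok(1)] front_of_iff[OF ok(2)]
        next_env[symmetric])
  then have "knowledge_action \<gamma> \<sigma> m (states_at \<gamma> P m) i (local_at r i m) = Go"
    using assms(2,4) rm by (simp add: implements_iff[OF assms(1)])
  \<comment> \<open>Knowledge is truthful: the actual state \<open>r m\<close> is among those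
    tested.\<close>
  then show ?thesis
    using rm by (auto simp: knowledge_action_def split: if_splits)
qed

lemma implements_safety:
  assumes "synchronous \<gamma>" "conflict_free \<gamma> \<sigma>" "implements \<gamma> P (policy_program \<gamma> \<sigma>)"
  shows "safety \<gamma> P"
  unfolding safety_def valid_in_def
proof (intro ballI allI impI)
  fix i j r m
  assume i: "i \<in> agents \<gamma>" and j: "j \<in> agents \<gamma>" and "i \<noteq> j" and r: "r \<in> runs \<gamma> P"
    and going: "going i r m \<and> going j r m"
  let ?s = "env (r m)"
  have ok: "queues_ok \<gamma> m ?s"
    using r by (auto simp: states_at_def intro!: queues_ok_states_at)
  have test: "policy_test \<gamma> \<sigma> m i (r m)" "policy_test \<gamma> \<sigma> m j (r m)"
    using going_policy_test[OF assms(1,3) r] i j going by blast+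
  obtain l l' where l: "occupies ?s i l 0" and l': "occupies ?s j l' 0"
    using test front_of_iff[OF ok] by (auto simp: policy_test_def)
  \<comment> \<open>Position 0 of one lane holds a single agent. The two moves are therefore
    distinct, as \<open>conflict_free\<close> requires.\<close>
  have "l \<noteq> l'" using l l' \<open>i \<noteq> j\<close> by (auto simp: occupies_def)
  have lanes: "lane_of ?s i = Here l" "lane_of ?s j = Here l'"
    using occupies_pos_lane(2)[OF ok] l l' by auto
  have "history \<gamma> (adv ?s) m \<in> histories \<gamma>"
    using ok by (auto simp: histories_def queues_ok_def)
  moreover have "(l, intent_of ?s i) \<in> \<sigma> (history \<gamma> (adv ?s) m)"
    "(l', intent_of ?s j) \<in> \<sigma> (history \<gamma> (adv ?s) m)"
    using test lanes by (auto simp: policy_test_def)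
  ultimately have "((l, intent_of ?s i), (l', intent_of ?s j)) \<in> compat \<gamma>"
    using assms(2) \<open>l \<noteq> l'\<close> unfolding conflict_free_def by blast
  then show "moves_compatible \<gamma> i j r m"
    using lanes by (auto simp: moves_compatible_def)
qed

theorem proposition16:
  fixes \<gamma> :: "('mem, 'x, 'msg) icontext" and \<sigma> :: policy
  assumes "intersection_context \<gamma>"
    and "synchronous \<gamma>"
    and "intersection_policy \<gamma> \<sigma>"
  shows "(\<exists>P. implements \<gamma> P (policy_program \<gamma> \<sigma>))
    \<and> (\<forall>P Q. implements \<gamma> P (policy_program \<gamma> \<sigma>) \<and> implements \<gamma> Q (policy_program \<gamma> \<sigma>)
          \<longrightarrow> behaviorally_equal \<gamma> P Q)
    \<and> (correct_policy \<gamma> \<sigma> \<longrightarrow>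
        (\<forall>P. implements \<gamma> P (policy_program \<gamma> \<sigma>) \<longrightarrow> safety \<gamma> P \<and> validity \<gamma> P))"
proof -
  \<comment> \<open>\<open>Front\<close> is a conjunct of \<open>going\<close>.\<close>
  have "validity \<gamma> P" for P
    by (simp add: validity_def valid_in_def going_def)
  then show ?thesis
    using implements_merged[OF assms(2)] implements_behaviorally_equal[OF assms(2)]
      implements_safety[OF assms(2)]
    unfolding correct_policy_def by blast
qed

end
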